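(* Let $k\ge d$ be positive integers. For every $\delta>0$ there exists an instance $v_1,\dots,v_n\in\mathbb{R}^d$ of the A-optimal design problem (with parameter $k$) such that $\mathrm{OPT}\ge\big(\frac{k}{k-d+1}-\delta\big)\mathrm{CP}$. This holds both without repetitions ($\mathrm{OPT}=\min_{|S|=k}\operatorname{tr}((\sum_{i\in S}v_iv_i^\top)^{-1})$, relaxation constraints $\sum_ix_i=k$, $0\le x_i\le1$) and with repetitions (minimum over $X\in\mathbb{Z}^n_{\ge0}$ with $\sum X_i=k$ of $\operatorname{tr}((\sum_iX_iv_iv_i^\top)^{-1})$, relaxation constraints $\sum_ix_i=k$, $x_i\ge0$).
   Context: $\mathrm{CP}$ is the optimal value of the relaxation minimizing $\operatorname{tr}\big((\sum_ix_iv_iv_i^\top)^{-1}\big)$ under the stated constraints; traces of inverses of singular matrices are $+\infty$. *)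

theory Defs
  imports "HOL-Analysis.Analysis"
begin

definition outer :: "real ^ 'd \<Rightarrow> real ^ 'd ^ 'd" where
  "outer v = (\<chi> i j. v $ i * v $ j)"

definition design_matrix :: "nat \<Rightarrow> (nat \<Rightarrow> real ^ 'd) \<Rightarrow> (nat \<Rightarrow> real) \<Rightarrow> real ^ 'd ^ 'd" where
  "design_matrix n v x = (\<Sum>i<n. x i *\<^sub>R outer (v i))"

definition tr_inv :: "real ^ 'd ^ 'd \<Rightarrow> ereal" where
  "tr_inv A = (if invertible A then ereal (trace (matrix_inv A)) else \<infinity>)"

text \<open>An instance consists of the vectors \<open>v 0, \<dots>, v (n - 1)\<close>.  Both infima
  \<open>OPT\<close> and \<open>OPT_rep\<close> range over finitely many values, so they are minima whenever
  there is a feasible solution; they are \<open>\<infinity>\<close> if there is none.\<close>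

definition OPT :: "nat \<Rightarrow> nat \<Rightarrow> (nat \<Rightarrow> real ^ 'd) \<Rightarrow> ereal" where
  "OPT k n v = (INF S \<in> {S. S \<subseteq> {..<n} \<and> card S = k}. tr_inv (\<Sum>i\<in>S. outer (v i)))"

definition CP :: "nat \<Rightarrow> nat \<Rightarrow> (nat \<Rightarrow> real ^ 'd) \<Rightarrow> ereal" where
  "CP k n v = (INF x \<in> {x. (\<Sum>i<n. x i) = real k \<and> (\<forall>i<n. 0 \<le> x i \<and> x i \<le> 1)}.
     tr_inv (design_matrix n v x))"

definition OPT_rep :: "nat \<Rightarrow> nat \<Rightarrow> (nat \<Rightarrow> real ^ 'd) \<Rightarrow> ereal" where
  "OPT_rep k n v = (INF X \<in> {X :: nat \<Rightarrow> nat. (\<Sum>i<n. X i) = k}.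
     tr_inv (design_matrix n v (\<lambda>i. real (X i))))"

definition CP_rep :: "nat \<Rightarrow> nat \<Rightarrow> (nat \<Rightarrow> real ^ 'd) \<Rightarrow> ereal" where
  "CP_rep k n v = (INF x \<in> {x. (\<Sum>i<n. x i) = real k \<and> (\<forall>i<n. 0 \<le> x i)}.
     tr_inv (design_matrix n v x))"

end

theory Submission
  imports Defs
begin

text \<open>Take \<open>k\<close> copies of each vector of an orthogonal basis in which one distinguished basis
  vector has length \<open>1\<close> and all others are very long. The long directions contribute almost
  nothing to the trace, so the relaxation gives them almost no weight and reaches about \<open>1 / k\<close>
  by spending its whole budget on the distinguished direction. An integral design must pick every
  long direction at least once to be nonsingular, which leaves at most \<open>k - d + 1\<close> for the
  distinguished direction and costs at least \<open>1 / (k - d + 1)\<close>.\<close>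

section \<open>Diagonal design matrices and the traces of their inverses\<close>

lemma matrix_inv_eq:
  fixes A B :: "real ^ 'd ^ 'd::finite"
  assumes "A ** B = mat 1"
  shows "matrix_inv A = B"
proof -
  have "A ** B = mat 1 \<and> B ** A = mat 1"
    using assms matrix_left_right_inverse by blast
  then have "A ** matrix_inv A = mat 1 \<and> matrix_inv A ** A = mat 1"
    unfolding matrix_inv_def by (rule someI)
  then have "matrix_inv A ** (A ** B) = B"
    by (simp add: matrix_mul_assoc)
  then show ?thesis
    using assms by simp
qed

lemma tr_inv_diagonal:
  fixes c :: "'d::finite \<Rightarrow> real"
  shows "tr_inv (\<chi> i j. if i = j then c i else 0) =
    (if \<forall>i. c i \<noteq> 0 then ereal (\<Sum>i\<in>UNIV. 1 / c i) else \<infinity>)"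
proof -
  let ?A = "(\<chi> i j. if i = j then c i else 0) :: real ^ 'd ^ 'd"
  let ?B = "(\<chi> i j. if i = j then 1 / c i else 0) :: real ^ 'd ^ 'd"
  have "det ?A = (\<Prod>i\<in>UNIV. c i)"
    by (subst det_diagonal) auto
  then have inv_iff: "invertible ?A \<longleftrightarrow> (\<forall>i. c i \<noteq> 0)"
    by (auto simp: invertible_det_nz)
  show ?thesis
  proof (cases "\<forall>i. c i \<noteq> 0")
    case True
    have "?A ** ?B = mat 1"
      using True by (auto simp: matrix_matrix_mult_def mat_def vec_eq_iff if_distrib[of "\<lambda>x. x * _"] cong: if_cong)
    then have "matrix_inv ?A = ?B"
      by (rule matrix_inv_eq)
    then show ?thesis
      using True inv_iff by (simp add: tr_inv_def trace_def)
  next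
    case False
    then show ?thesis
      using inv_iff by (auto simp: tr_inv_def)
  qed
qed

text \<open>Vectors along coordinate axes have diagonal outer products. With \<open>h i\<close> the
  axis of vector \<open>i\<close> and \<open>w\<close> the length attached to each axis, a design
  matters only through its total weight on each fibre of \<open>h\<close>.\<close>

lemma design_matrix_axis:
  fixes h :: "nat \<Rightarrow> 'd::finite" and w :: "'d \<Rightarrow> real"
  shows "design_matrix n (\<lambda>i. w (h i) *\<^sub>R axis (h i) 1) x =
    (\<chi> p q. if p = q then (w p)\<^sup>2 * (\<Sum>i | i < n \<and> h i = p. x i) else 0)"
proof -
  have "(\<Sum>i<n. x i * (w (h i) * axis (h i) 1 $ p * (w (h i) * axis (h i) 1 $ q))) =
      (if p = q then (w p)\<^sup>2 * (\<Sum>i | i < n \<and> h i = p. x i) else 0)" for p q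
  proof (cases "p = q")
    case True
    have "(\<Sum>i<n. x i * (w (h i) * axis (h i) 1 $ p * (w (h i) * axis (h i) 1 $ q))) =
        (\<Sum>i<n. if h i = p then (w p)\<^sup>2 * x i else 0)"
      using True by (intro sum.cong) (auto simp: axis_def power2_eq_square)
    also have "\<dots> = (\<Sum>i | i < n \<and> h i = p. (w p)\<^sup>2 * x i)"
      by (simp add: sum.inter_filter[symmetric])
    finally show ?thesis
      using True by (simp add: sum_distrib_left)
  next
    case False
    then show ?thesis
      by (auto simp: axis_def intro!: sum.neutral)
  qed
  then show ?thesis
    by (simp add: design_matrix_def outer_def vec_eq_iff)
qed

lemma tr_inv_design_matrix_axis:
  fixes h :: "nat \<Rightarrow> 'd::finite" and w :: "'d \<Rightarrow> real"
  assumes "\<And>j. w j \<noteq> 0"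
  shows "tr_inv (design_matrix n (\<lambda>i. w (h i) *\<^sub>R axis (h i) 1) x) =
    (if \<forall>j. (\<Sum>i | i < n \<and> h i = j. x i) \<noteq> 0
     then ereal (\<Sum>j\<in>UNIV. 1 / ((w j)\<^sup>2 * (\<Sum>i | i < n \<and> h i = j. x i))) else \<infinity>)"
  using assms by (simp add: design_matrix_axis tr_inv_diagonal)

lemma sum_fibres:
  fixes h :: "nat \<Rightarrow> 'd::finite" and x :: "nat \<Rightarrow> 'a::comm_monoid_add"
  shows "(\<Sum>j\<in>UNIV. \<Sum>i | i < n \<and> h i = j. x i) = (\<Sum>i<n. x i)"
  using sum.group[of "{..<n}" UNIV h x] by simp

section \<open>Comparison of the variants with and without repetitions\<close>

lemma sum_outer_eq_design_matrix:
  assumes "S \<subseteq> {..<n}"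
  shows "(\<Sum>i\<in>S. outer (v i)) = design_matrix n v (\<lambda>i. real (if i \<in> S then 1 else 0))"
proof -
  have "design_matrix n v (\<lambda>i. real (if i \<in> S then 1 else 0)) =
      (\<Sum>i<n. if i \<in> S then outer (v i) else 0)"
    unfolding design_matrix_def by (intro sum.cong) auto
  also have "\<dots> = (\<Sum>i\<in>S. outer (v i))"
    using assms by (simp add: sum.inter_restrict[symmetric] Int_absorb1)
  finally show ?thesis ..
qed

text \<open>A subset is a choice of multiplicities 0 and 1. A lower bound proved with repetitions
  thus serves both variants.\<close>

lemma OPT_rep_le_OPT: "OPT_rep k n v \<le> OPT k n v"
  unfolding OPT_def
proof (rule INF_greatest)
  fix S assume S: "S \<in> {S. S \<subseteq> {..<n} \<and> card S = k}"
  then have "(\<Sum>i<n. if i \<in> S then 1 else (0::nat)) = k"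
    by (simp add: sum.inter_restrict[symmetric] Int_absorb1)
  then show "OPT_rep k n v \<le> tr_inv (\<Sum>i\<in>S. outer (v i))"
    using S unfolding OPT_rep_def by (intro INF_lower2) (auto simp: sum_outer_eq_design_matrix)
qed

lemma CP_rep_le_CP: "CP_rep k n v \<le> CP k n v"
  unfolding CP_rep_def CP_def by (rule INF_superset_mono) auto

section \<open>Optimal values for vectors along the axes, and their labelling\<close>

lemma CP_rep_axis_nonneg:
  fixes h :: "nat \<Rightarrow> 'd::finite" and w :: "'d \<Rightarrow> real"
  assumes "\<And>j. w j \<noteq> 0"
  shows "0 \<le> CP_rep k n (\<lambda>i. w (h i) *\<^sub>R axis (h i) 1)"
  unfolding CP_rep_def
  by (intro INF_greatest)
    (auto simp: tr_inv_design_matrix_axis[of w, OF assms] intro!: sum_nonneg divide_nonneg_nonneg mult_nonneg_nonneg)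

text \<open>A nonsingular design uses every axis, so at most \<open>k - CARD('d) + 1\<close> picks
  remain for axis \<open>a\<close>; the trace term of that axis alone yields the bound.\<close>

lemma OPT_rep_axis_ge:
  fixes h :: "nat \<Rightarrow> 'd::finite" and w :: "'d \<Rightarrow> real"
  assumes w: "\<And>j. w j \<noteq> 0" and a: "w a = 1"
  shows "ereal (1 / (real k - real CARD('d) + 1)) \<le> OPT_rep k n (\<lambda>i. w (h i) *\<^sub>R axis (h i) 1)"
  unfolding OPT_rep_def
proof (rule INF_greatest)
  fix X :: "nat \<Rightarrow> nat" assume "X \<in> {X. (\<Sum>i<n. X i) = k}"
  then have X: "(\<Sum>i<n. X i) = k" by simp
  define s where "s j = (\<Sum>i | i < n \<and> h i = j. X i)" for j
  have s_real: "(\<Sum>i | i < n \<and> h i = j. real (X i)) = real (s j)" for j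
    by (simp add: s_def)
  show "ereal (1 / (real k - real CARD('d) + 1)) \<le>
      tr_inv (design_matrix n (\<lambda>i. w (h i) *\<^sub>R axis (h i) 1) (\<lambda>i. real (X i)))"
  proof (cases "\<forall>j. s j \<noteq> 0")
    case True
    have "k = (\<Sum>j\<in>UNIV. s j)"
      unfolding s_def using X sum_fibres[where h = h and n = n and x = X] by simp
    also have "\<dots> = s a + (\<Sum>j\<in>UNIV - {a}. s j)"
      by (rule sum.remove) auto
    finally have "k = s a + (\<Sum>j\<in>UNIV - {a}. s j)" .
    \<comment> \<open>Integrality enters here: a nonzero natural number \<open>s j\<close> is at
      least 1.\<close>
    moreover have "CARD('d) - 1 \<le> (\<Sum>j\<in>UNIV - {a}. s j)"
      using sum_mono[of "UNIV - {a}" "\<lambda>_. 1" s] True by (simp add: Suc_le_eq)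
    moreover have "0 < CARD('d)" by simp
    ultimately have "real (s a) \<le> real k - real CARD('d) + 1"
      by linarith
    then have "1 / (real k - real CARD('d) + 1) \<le> 1 / real (s a)"
      using True by (intro frac_le) auto
    also have "\<dots> = 1 / ((w a)\<^sup>2 * real (s a))"
      by (simp add: a)
    also have "\<dots> \<le> (\<Sum>j\<in>UNIV. 1 / ((w j)\<^sup>2 * real (s j)))"
      by (rule member_le_sum) auto
    finally show ?thesis
      using True by (simp add: tr_inv_design_matrix_axis[of w, OF w] s_real)
  next
    \<comment> \<open>An axis that is never picked makes the matrix singular, with trace value
      infinity.\<close>
    case False
    then show ?thesis
      unfolding tr_inv_design_matrix_axis[of w, OF w] s_real of_nat_eq_0_iff if_not_P[OF False]
      by simp
  qed
qed

lemma OPT_axis_finite: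
  fixes h :: "nat \<Rightarrow> 'd::finite" and w :: "'d \<Rightarrow> real"
  assumes w: "\<And>j. w j \<noteq> 0" and "k \<le> n" and hit: "\<And>j. \<exists>i<k. h i = j"
  shows "OPT k n (\<lambda>i. w (h i) *\<^sub>R axis (h i) 1) < \<infinity>"
proof -
  let ?v = "\<lambda>i. w (h i) *\<^sub>R axis (h i) (1::real)"
  have sub: "{..<k} \<subseteq> {..<n}" using \<open>k \<le> n\<close> by auto
  have "(\<Sum>i | i < n \<and> h i = j. real (if i \<in> {..<k} then 1 else 0)) > 0" for j
  proof -
    obtain i where "i < k" "h i = j" using hit by blast
    then show ?thesis
      using \<open>k \<le> n\<close> by (intro sum_pos2[of _ i]) auto
  qed
  then have "\<forall>j. (\<Sum>i | i < n \<and> h i = j. real (if i \<in> {..<k} then 1 else 0)) \<noteq> 0"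
    by (metis less_irrefl)
  then have "tr_inv (\<Sum>i\<in>{..<k}. outer (?v i)) < \<infinity>"
    unfolding sum_outer_eq_design_matrix[OF sub] tr_inv_design_matrix_axis[of w, OF w] by simp
  moreover have "OPT k n ?v \<le> tr_inv (\<Sum>i\<in>{..<k}. outer (?v i))"
    unfolding OPT_def using sub by (intro INF_lower) auto
  ultimately show ?thesis by (rule le_less_trans[rotated])
qed

text \<open>The mass \<open>s j\<close> is spread evenly over the \<open>k\<close> copies of axis
  \<open>j\<close>. Having \<open>k\<close> copies turns \<open>s j \<le> k\<close> into the
  constraint that each weight is at most 1, so the design is feasible even without
  repetitions.\<close>

lemma CP_axis_le:
  fixes h :: "nat \<Rightarrow> 'd::finite" and w s :: "'d \<Rightarrow> real"
  assumes w: "\<And>j. w j \<noteq> 0" and fibre: "\<And>j. card {i. i < n \<and> h i = j} = k"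
    and s: "\<And>j. 0 < s j" "\<And>j. s j \<le> real k" "(\<Sum>j\<in>UNIV. s j) = real k"
  shows "CP k n (\<lambda>i. w (h i) *\<^sub>R axis (h i) 1) \<le> ereal (\<Sum>j\<in>UNIV. 1 / ((w j)\<^sup>2 * s j))"
proof -
  have k: "0 < real k" using s(1,2) by (meson less_le_trans)
  define x where "x i = s (h i) / real k" for i
  have x_fibre: "(\<Sum>i | i < n \<and> h i = j. x i) = s j" for j
  proof -
    have "(\<Sum>i | i < n \<and> h i = j. x i) = (\<Sum>i | i < n \<and> h i = j. s j / real k)"
      by (intro sum.cong) (auto simp: x_def)
    then show ?thesis using fibre k by simp
  qed
  have "(\<Sum>i<n. x i) = real k"
    using sum_fibres[where h = h and n = n and x = x] by (simp add: x_fibre s(3))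
  moreover have "0 \<le> x i \<and> x i \<le> 1" for i
    using s(1,2) k by (simp add: x_def less_imp_le)
  moreover have "tr_inv (design_matrix n (\<lambda>i. w (h i) *\<^sub>R axis (h i) 1) x) =
      ereal (\<Sum>j\<in>UNIV. 1 / ((w j)\<^sup>2 * s j))"
    using s(1) by (auto simp: tr_inv_design_matrix_axis[of w, OF w] x_fibre dest: less_imp_neq[THEN not_sym])
  ultimately show ?thesis
    unfolding CP_def by (intro INF_lower2[of x]) auto
qed

text \<open>Labelling by residues modulo \<open>CARD('d)\<close> gives every axis \<open>k\<close>
  indices, and the first \<open>CARD('d)\<close> indices already meet all axes; the latter makes
  \<open>OPT\<close> finite.\<close>

lemma equidistributed_labelling:
  obtains h :: "nat \<Rightarrow> 'd::finite"
  where "\<And>j. card {i. i < k * CARD('d) \<and> h i = j} = k" "\<And>j. \<exists>i<CARD('d). h i = j"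
proof -
  let ?d = "CARD('d)"
  obtain f :: "nat \<Rightarrow> 'd" where f: "bij_betw f {0..<?d} UNIV"
    using ex_bij_betw_nat_finite[of "UNIV :: 'd set"] by auto
  have ex: "\<exists>m<?d. f m = j" for j
    using bij_betw_imp_surj_on[OF f] by (metis UNIV_I atLeastLessThan_iff imageE)
  have "card {i. i < k * ?d \<and> f (i mod ?d) = j} = k" for j
  proof -
    obtain m where m: "m < ?d" "f m = j" using ex by blast
    have eq: "f (i mod ?d) = j \<longleftrightarrow> i mod ?d = m" for i
      using m bij_betw_imp_inj_on[OF f] by (auto dest!: inj_onD)
    have "{i. i < k * ?d \<and> f (i mod ?d) = j} = (\<lambda>q. q * ?d + m) ` {..<k}"
    proof (intro equalityI subsetI)
      fix i assume "i \<in> {i. i < k * ?d \<and> f (i mod ?d) = j}"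
      then have "i div ?d < k" "i = (i div ?d) * ?d + m"
        using eq by (auto simp: less_mult_imp_div_less)
      then show "i \<in> (\<lambda>q. q * ?d + m) ` {..<k}" by blast
    next
      fix i assume "i \<in> (\<lambda>q. q * ?d + m) ` {..<k}"
      then obtain q where q: "q < k" "i = q * ?d + m" by blast
      have "q * ?d + m < Suc q * ?d" using m by simp
      also have "\<dots> \<le> k * ?d" using q by (intro mult_le_mono1) simp
      finally show "i \<in> {i. i < k * ?d \<and> f (i mod ?d) = j}" using q m by simp
    qed
    moreover have "inj_on (\<lambda>q. q * ?d + m) {..<k}"
      by (auto intro!: inj_onI)
    ultimately show ?thesis by (simp add: card_image)
  qed
  moreover have "\<exists>i<?d. f (i mod ?d) = j" for j
    using ex[of j] by auto
  ultimately show ?thesis using that[of "\<lambda>i. f (i mod ?d)"] by blast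
qed

section \<open>Choice of the instance and the gap\<close>

theorem theoremC3:
  fixes k :: nat and \<delta> :: real
  assumes "CARD('d::finite) \<le> k" and "\<delta> > 0"
  shows "(\<exists>n (v :: nat \<Rightarrow> real ^ 'd). OPT k n v < \<infinity> \<and>
            OPT k n v \<ge> ereal (real k / (real k - real CARD('d) + 1) - \<delta>) * CP k n v) \<and>
         (\<exists>n (v :: nat \<Rightarrow> real ^ 'd). OPT_rep k n v < \<infinity> \<and>
            OPT_rep k n v \<ge> ereal (real k / (real k - real CARD('d) + 1) - \<delta>) * CP_rep k n v)"
proof -
  define d where "d = CARD('d)"
  define L where "L = 1 / (real k - real d + 1)"
  define c where "c = real k * L - \<delta>"
  have d: "0 < d" "d \<le> k" using assms(1) by (auto simp: d_def)
  then have k: "0 < real k" by simp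
  have L: "0 < L" using d by (simp add: L_def)
  \<comment> \<open>The bracket is the cost of the fractional design chosen below. As \<epsilon>
    tends to 0 the product tends to \<open>c / k = L - \<delta> / k\<close>, which is less than
    \<open>L\<close>, so some small positive \<epsilon> works.\<close>
  have "((\<lambda>\<epsilon>. c * (1 / (real k - \<epsilon> * (real d - 1)) + (real d - 1) * \<epsilon>)) \<longlongrightarrow>
      c * (1 / (real k - 0 * (real d - 1)) + (real d - 1) * 0)) (at_right 0)"
    using k by (intro tendsto_intros) auto
  moreover have "c * (1 / (real k - 0 * (real d - 1)) + (real d - 1) * 0) < L"
    using k \<open>\<delta> > 0\<close> by (simp add: c_def field_simps)
  ultimately have "\<forall>\<^sub>F \<epsilon> in at_right 0.
      c * (1 / (real k - \<epsilon> * (real d - 1)) + (real d - 1) * \<epsilon>) < L"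
    by (rule order_tendstoD)
  moreover have "\<forall>\<^sub>F \<epsilon> in at_right (0::real). \<epsilon> \<in> {0<..<1}"
    by (rule eventually_at_right_real) simp
  ultimately have "\<forall>\<^sub>F \<epsilon> in at_right 0.
      c * (1 / (real k - \<epsilon> * (real d - 1)) + (real d - 1) * \<epsilon>) < L \<and> \<epsilon> \<in> {0<..<1}"
    by (rule eventually_conj)
  then obtain \<epsilon> where \<epsilon>: "0 < \<epsilon>" "\<epsilon> < 1"
    and bound: "c * (1 / (real k - \<epsilon> * (real d - 1)) + (real d - 1) * \<epsilon>) < L"
    by (auto dest!: eventually_happens'[rotated])
  obtain h :: "nat \<Rightarrow> 'd"
    where h: "\<And>j. card {i. i < k * d \<and> h i = j} = k" "\<And>j. \<exists>i<d. h i = j"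
    unfolding d_def using equidistributed_labelling[where 'd = 'd and k = k] by blast
  \<comment> \<open>Any element of the index type may serve as the distinguished axis.\<close>
  define a :: 'd where "a = undefined"
  \<comment> \<open>With length \<open>1 / \<epsilon>\<close> and mass \<epsilon>, each long axis
    adds exactly \<epsilon> to the trace; \<open>t\<close> is the mass left for axis
    \<open>a\<close>.\<close>
  define w where "w j = (if j = a then 1 else 1 / \<epsilon>)" for j
  define t where "t = real k - \<epsilon> * (real d - 1)"
  define s where "s j = (if j = a then t else \<epsilon>)" for j
  define n where "n = k * d"
  define v where "v i = w (h i) *\<^sub>R axis (h i) (1::real)" for i
  have w: "w j \<noteq> 0" for j using \<epsilon> by (simp add: w_def)
  have "\<epsilon> * (real d - 1) \<le> 1 * (real d - 1)"
    using \<epsilon> d by (intro mult_right_mono) auto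
  then have t: "0 < t" "t \<le> real k"
    using d \<epsilon> by (auto simp: t_def)
  have split: "(\<Sum>j\<in>UNIV. g j) = g a + (\<Sum>j\<in>UNIV - {a}. g j)" for g :: "'d \<Rightarrow> real"
    by (rule sum.remove) auto
  have card_a: "real (CARD('d) - Suc 0) = real d - 1"
    using d by (simp add: d_def of_nat_diff)
  have s: "(\<Sum>j\<in>UNIV. s j) = real k"
    by (simp add: split s_def t_def card_a)
  have trace: "(\<Sum>j\<in>UNIV. 1 / ((w j)\<^sup>2 * s j)) = 1 / t + (real d - 1) * \<epsilon>"
    using \<epsilon> by (simp add: split s_def w_def power2_eq_square card_a)
  have CP_le: "CP k n v \<le> ereal (1 / t + (real d - 1) * \<epsilon>)"
    unfolding v_def trace[symmetric]
  proof (rule CP_axis_le[of w, OF w _ _ _ s])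
    show "card {i. i < n \<and> h i = j} = k" for j using h(1) by (simp add: n_def)
    show "0 < s j" for j using t \<epsilon> by (simp add: s_def)
    show "s j \<le> real k" for j using t \<epsilon> d by (simp add: s_def)
  qed
  have OPT_rep_ge: "ereal L \<le> OPT_rep k n v"
    unfolding v_def L_def d_def by (rule OPT_rep_axis_ge[of w, OF w, where a = a]) (simp add: w_def)
  have OPT_fin: "OPT k n v < \<infinity>"
    unfolding v_def
  proof (rule OPT_axis_finite[of w, OF w])
    show "k \<le> n" using d by (simp add: n_def)
    show "\<exists>i<k. h i = j" for j using h(2)[of j] d(2) order_less_le_trans by blast
  qed
  have CP_rep_nonneg: "0 \<le> CP_rep k n v"
    unfolding v_def by (rule CP_rep_axis_nonneg[of w, OF w])
  \<comment> \<open>Stated for every \<open>y\<close> between 0 and \<open>CP\<close>, this covers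
    both relaxations. The two bounds also force \<open>y\<close> to be a finite real.\<close>
  have key: "ereal c * y \<le> ereal L" if y: "0 \<le> y" "y \<le> CP k n v" for y
  proof -
    obtain r where r: "y = ereal r" "0 \<le> r" "r \<le> 1 / t + (real d - 1) * \<epsilon>"
      using y(1) order_trans[OF y(2) CP_le] by (cases y) auto
    have "c * r \<le> L"
    proof (cases "0 \<le> c")
      case True
      then show ?thesis
        using mult_left_mono[OF r(3) True] bound by (simp add: t_def)
    next
      \<comment> \<open>A large \<delta> can make \<open>c\<close> negative, and then the upper
        bound on \<open>r\<close> is of no help; the signs alone suffice.\<close>
      case False
      then have "c * r \<le> 0" using r by (simp add: mult_nonpos_nonneg)
      then show ?thesis using L by simp
    qed
    then show ?thesis using r by simp
  qed
  have c: "real k / (real k - real CARD('d) + 1) - \<delta> = c"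
    by (simp add: c_def L_def d_def)
  have "ereal c * CP k n v \<le> OPT k n v"
    using order_trans[OF key order_trans[OF OPT_rep_ge OPT_rep_le_OPT]]
      order_trans[OF CP_rep_nonneg CP_rep_le_CP] by blast
  moreover have "ereal c * CP_rep k n v \<le> OPT_rep k n v"
    using order_trans[OF key[OF CP_rep_nonneg CP_rep_le_CP] OPT_rep_ge] .
  moreover have "OPT_rep k n v < \<infinity>"
    using OPT_fin OPT_rep_le_OPT[of k n v] by (rule le_less_trans[rotated])
  ultimately show ?thesis
    using OPT_fin unfolding c by blast
qed

end
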